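(* For every finite group $G$, the cyclic subgroup graph $\Gamma(G)$ is bipartite.
   Context: For a finite group $G$, the cyclic subgroup graph $\Gamma(G)$ is the simple undirected graph whose vertex set is $C(G)$, the set of all cyclic subgroups of $G$ (including the trivial subgroup $\{e\}$), and in which two distinct vertices are adjacent if and only if one of them, $H_1$, is contained in the other, $H_2$, and there is no subgroup $K$ of $G$ with $H_1<K<H_2$ (strict inclusions). *)

theory Defs
  imports "HOL-Algebra.Elementary_Groups" "Graph_Theory.Pair_Digraph"
begin

definition cyclic_subgroups :: "('a, 'b) monoid_scheme \<Rightarrow> 'a set set" where
  "cyclic_subgroups G = {H. subgroup H G \<and> cyclic_group (G\<lparr>carrier := H\<rparr>)}"

text \<open>
  The intermediate subgroup \<open>K\<close> ranges over all subgroups of \<open>G\<close>, not only the cyclic ones.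
\<close>

definition covered_by :: "('a, 'b) monoid_scheme \<Rightarrow> 'a set \<Rightarrow> 'a set \<Rightarrow> bool" where
  "covered_by G H1 H2 \<longleftrightarrow> H1 \<subset> H2 \<and> \<not> (\<exists>K. subgroup K G \<and> H1 \<subset> K \<and> K \<subset> H2)"

text \<open>
  An undirected edge is represented by its two opposite arcs, following the convention of
  \<^locale>\<open>pair_graph\<close>.
\<close>

definition cyclic_subgroup_graph :: "('a, 'b) monoid_scheme \<Rightarrow> 'a set pair_pre_digraph" where
  "cyclic_subgroup_graph G =
    \<lparr>pverts = cyclic_subgroups G,
     parcs = {(H1, H2). H1 \<in> cyclic_subgroups G \<and> H2 \<in> cyclic_subgroups G \<and>
                (covered_by G H1 H2 \<or> covered_by G H2 H1)}\<rparr>"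

text \<open>
  A part may be empty: the cyclic subgroup graph of the trivial group has a single vertex.
\<close>

definition bipartite :: "('a, 'b) pre_digraph \<Rightarrow> bool" where
  "bipartite \<Gamma> \<longleftrightarrow> graph \<Gamma> \<and>
    (\<exists>U V. verts \<Gamma> = U \<union> V \<and> U \<inter> V = {} \<and>
      (\<forall>e \<in> arcs \<Gamma>. (tail \<Gamma> e \<in> U \<and> head \<Gamma> e \<in> V) \<or> (tail \<Gamma> e \<in> V \<and> head \<Gamma> e \<in> U)))"

lemma (in group) cyclic_subgroups_eq_generate:
  "cyclic_subgroups G = (\<lambda>x. generate G {x}) ` carrier G"
proof (intro equalityI subsetI)
  fix H assume "H \<in> cyclic_subgroups G"
  then have H: "subgroup H G" and c: "cyclic_group (G\<lparr>carrier := H\<rparr>)"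
    by (auto simp: cyclic_subgroups_def)
  from c obtain x where x: "x \<in> H" "subgroup_generated (G\<lparr>carrier := H\<rparr>) {x} = G\<lparr>carrier := H\<rparr>"
    by (auto simp: cyclic_group_def)
  have "carrier (subgroup_generated (G\<lparr>carrier := H\<rparr>) {x}) = H"
    using x(2) by simp
  then have "generate (G\<lparr>carrier := H\<rparr>) {x} = H"
    using x(1) by (simp add: carrier_subgroup_generated)
  then have "generate G {x} = H"
    using generate_consistent[of "{x}" H] H x(1) by simp
  then show "H \<in> (\<lambda>x. generate G {x}) ` carrier G"
    using x(1) subgroup.subset[OF H] by auto
next
  fix H assume "H \<in> (\<lambda>x. generate G {x}) ` carrier G"
  then obtain x where x: "x \<in> carrier G" "H = generate G {x}" by auto
  then have "subgroup_generated G {x} = G\<lparr>carrier := H\<rparr>"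
    by (simp add: subgroup_generated_def)
  then have "cyclic_group (G\<lparr>carrier := H\<rparr>)"
    using cyclic_group_generated[of x] by simp
  moreover have "subgroup H G" using x generate_is_subgroup by simp
  ultimately show "H \<in> cyclic_subgroups G" by (simp add: cyclic_subgroups_def)
qed

lemma (in group) pair_graph_cyclic_subgroup_graph:
  assumes "finite (carrier G)"
  shows "pair_graph (cyclic_subgroup_graph G)"
proof -
  have fin: "finite (cyclic_subgroups G)"
    using assms by (simp add: cyclic_subgroups_eq_generate)
  have "finite (parcs (cyclic_subgroup_graph G))"
    by (rule finite_subset[of _ "cyclic_subgroups G \<times> cyclic_subgroups G"])
       (use fin in \<open>auto simp: cyclic_subgroup_graph_def\<close>)
  with fin show ?thesis
    by unfold_locales
       (auto simp: cyclic_subgroup_graph_def covered_by_def symmetric_def with_proj_def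
         arcs_ends_def arc_to_ends_def intro!: symI)
qed

end

theory Submission
  imports Defs "HOL-Algebra.Multiplicative_Group" "HOL-Computational_Algebra.Primes"
begin

text \<open>
  The proper 2-colouring sends a cyclic subgroup \<open>H\<close> to the parity of the number of prime factors
  of \<open>card H\<close>, counted with multiplicity. It suffices that adjacent vertices have orders differing
  by exactly one prime factor, which is lemma \<open>card_covered_by_cyclic\<close>: if \<open>H\<close> is covered by
  \<open>\<langle>x\<rangle>\<close>, then its index is a prime. Indeed, let \<open>p\<close> be any prime divisor of the index of \<open>H\<close>.
  Every element of \<open>H\<close> is a power of \<open>x\<close> whose exponent is a multiple of that index, hence of \<open>p\<close>,
  so \<open>H\<close> is contained in the proper subgroup \<open>\<langle>x\<^sup>p\<rangle>\<close> of \<open>\<langle>x\<rangle>\<close>, and the covering relation forces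
  \<open>H = \<langle>x\<^sup>p\<rangle>\<close>, a subgroup of index \<open>p\<close>.
\<close>

lemma (in group) card_subgroup_dvd:
  assumes "subgroup H G" "subgroup K G" "H \<subseteq> K"
  shows "card H dvd card K"
proof -
  interpret K: group "G\<lparr>carrier := K\<rparr>"
    using assms(2) by (rule subgroup.subgroup_is_group) (rule is_group)
  have "subgroup H (G\<lparr>carrier := K\<rparr>)"
    using subgroup_incl assms by blast
  from K.lagrange[OF this] have "card (rcosets\<^bsub>G\<lparr>carrier := K\<rparr>\<^esub> H) * card H = card K"
    by (simp add: order_def)
  from this[symmetric] show ?thesis
    by simp
qed

lemma (in group) card_covered_by_cyclic:
  assumes fin: "finite (carrier G)" and x: "x \<in> carrier G"
    and H: "subgroup H G" and cov: "covered_by G H (generate G {x})"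
  obtains p :: nat where "prime p" "card (generate G {x}) = p * card H"
proof -
  let ?n = "card (generate G {x})"
  have n: "?n = ord x"
    using generate_pow_card[OF x] by simp
  have sub: "H \<subset> generate G {x}"
    using cov by (simp add: covered_by_def)
  have gx: "subgroup (generate G {x}) G"
    using x by (intro generate_is_subgroup) auto
  have fin_gx: "finite (generate G {x})"
    using fin subgroup.subset[OF gx] finite_subset by blast
  have "card H dvd ?n"
    using card_subgroup_dvd[OF H gx] sub by blast
  then obtain m where m: "?n = card H * m" ..
  have less: "card H < ?n"
    using psubset_card_mono[OF fin_gx sub] .
  then have "m \<noteq> 1" and pos: "?n > 0"
    using m by auto
  then obtain p where p: "prime p" "p dvd m"
    using prime_factor_nat by blast
  have p0: "p \<noteq> 0"
    using prime_gt_0_nat[OF p(1)] by simp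
  have pn: "p dvd ord x"
    unfolding n[symmetric] m using p(2) by (rule dvd_mult)
  have xp: "x [^] p \<in> carrier G"
    using x by simp
  let ?K = "generate G {x [^] p}"
  have K: "subgroup ?K G"
    using xp by (intro generate_is_subgroup) auto
  have card_K: "p * card ?K = ?n"
    using generate_pow_card[OF xp] ord_pow[OF x pn p0] dvd_mult_div_cancel[OF pn] n by simp
  have "H \<subseteq> ?K"
  proof
    fix a assume a: "a \<in> H"
    obtain j :: nat where j: "a = x [^] j"
      using a sub generate_pow_on_finite_carrier[OF fin x] by blast
    have a_carrier: "a \<in> carrier G"
      using x j by simp
    have "subgroup (generate G {a}) G"
      using a_carrier by (intro generate_is_subgroup) auto
    moreover have "generate G {a} \<subseteq> H"
      using a H by (intro generate_subgroup_incl) auto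
    ultimately have "ord a dvd card H"
      using card_subgroup_dvd[OF _ H] generate_pow_card[OF a_carrier] by simp
    \<comment> \<open>Hence \<open>ord x = card H * m\<close> divides \<open>j * card H\<close>, so the index \<open>m\<close> divides the exponent \<open>j\<close>.\<close>
    then have "x [^] (j * card H) = \<one>"
      using pow_eq_id[OF a_carrier] x j by (simp add: nat_pow_pow)
    then have "card H * m dvd card H * j"
      using pow_eq_id[OF x] n m by (simp add: mult.commute)
    then have "m dvd j"
      using m pos by simp
    then obtain i where "j = p * i"
      using p(2) dvd_trans by blast
    then have "a = (x [^] p) [^] i"
      using x j by (simp add: nat_pow_pow)
    then show "a \<in> ?K"
      using generate_pow_on_finite_carrier[OF fin xp] by blast
  qed
  moreover have "?K \<subset> generate G {x}"
  proof -
    have "x [^] p \<in> generate G {x}"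
      using generate_pow_on_finite_carrier[OF fin x] by blast
    then have "?K \<subseteq> generate G {x}"
      using gx by (intro generate_subgroup_incl) auto
    moreover have "card ?K \<noteq> ?n"
      using card_K pos prime_gt_1_nat[OF p(1)] by auto
    ultimately show ?thesis by (intro psubsetI notI) simp_all
  qed
  ultimately have "H = ?K"
    using cov K unfolding covered_by_def by blast
  with card_K have "?n = p * card H" by simp
  with p(1) show thesis by (rule that)
qed

lemma (in group) even_prime_factors_covered_by:
  assumes fin: "finite (carrier G)"
    and "H \<in> cyclic_subgroups G" "K \<in> cyclic_subgroups G" "covered_by G H K"
  shows "even (size (prime_factorization (card H))) \<longleftrightarrow>
    odd (size (prime_factorization (card K)))"
proof -
  obtain x where x: "x \<in> carrier G" "K = generate G {x}"
    using assms(3) by (auto simp: cyclic_subgroups_eq_generate)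
  have H: "subgroup H G"
    using assms(2) by (simp add: cyclic_subgroups_def)
  obtain p where p: "prime p" "card K = p * card H"
    using card_covered_by_cyclic[OF fin x(1) H] assms(4) unfolding x(2) by blast
  have "card H \<noteq> 0"
    using finite_subset[OF subgroup.subset[OF H] fin] subgroup.one_closed[OF H] by auto
  moreover have "p \<noteq> 0"
    using prime_gt_0_nat[OF p(1)] by simp
  ultimately have "prime_factorization (card K) = {#p#} + prime_factorization (card H)"
    using p by (simp add: prime_factorization_mult prime_factorization_prime)
  then show ?thesis by simp
qed

theorem proposition2p2:
  fixes G :: "('a, 'b) monoid_scheme"
  assumes "group G" and "finite (carrier G)"
  shows "bipartite (with_proj (cyclic_subgroup_graph G))"
proof -
  interpret group G by fact
  interpret \<Gamma>: pair_graph "cyclic_subgroup_graph G"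
    using assms(2) by (rule pair_graph_cyclic_subgroup_graph)
  let ?even = "\<lambda>H. even (size (prime_factorization (card H)))"
  let ?U = "{H \<in> cyclic_subgroups G. ?even H}"
  let ?V = "{H \<in> cyclic_subgroups G. \<not> ?even H}"
  have "graph (with_proj (cyclic_subgroup_graph G))"
    by (rule \<Gamma>.graph_axioms)
  moreover have "verts (with_proj (cyclic_subgroup_graph G)) = ?U \<union> ?V"
    by (auto simp: cyclic_subgroup_graph_def)
  moreover have "?U \<inter> ?V = {}" by blast
  moreover have "(fst e \<in> ?U \<and> snd e \<in> ?V) \<or> (fst e \<in> ?V \<and> snd e \<in> ?U)"
    if "e \<in> parcs (cyclic_subgroup_graph G)" for e
    using that even_prime_factors_covered_by[OF assms(2)]
    by (auto simp: cyclic_subgroup_graph_def)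
  ultimately show ?thesis
    unfolding bipartite_def with_proj_simps by blast
qed

end
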